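(* For each integer $m\geq 0$, $$\frac{\pi}{4} = \sum_{n=0}^\infty \frac{(-1)^n}{2n+1} L_{2m(2n+1)} \Big (\frac{2}{L_{2m} + \sqrt{L_{2m}^2+4}}\Big )^{2n+1},$$ where $L_k$ denotes the $k$-th Lucas number.
   Context: The Lucas numbers are defined by $L_0=2$, $L_1=1$, and $L_{n+2}=L_{n+1}+L_n$ for $n\ge 0$. *)

theory Defs
  imports Complex_Main
begin

fun lucas :: "nat \<Rightarrow> nat" where
  "lucas 0 = 2"
| "lucas (Suc 0) = 1"
| "lucas (Suc (Suc n)) = lucas (Suc n) + lucas n"

end

(* With a, b the 2m-th powers of the golden ratio and its conjugate, a b = 1 and L_{2m} = a + b, and
   the sum splits into arctan (a x) + arctan (b x), where x is the positive root of
   x^2 + L_{2m} x = 1.  The addition theorem gives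
   arctan ((a + b) x / (1 - x^2)) = arctan 1. *)
theory Submission
  imports Defs
begin

text \<open>Powers of a root of r^2 = r + 1 obey the Lucas recurrence, and p + q = 1 gives the right
  value at index 1.\<close>

lemma lucas_eq_power_sum:
  fixes p q :: "'a :: comm_semiring_1"
  assumes "p + q = 1" "p\<^sup>2 = p + 1" "q\<^sup>2 = q + 1"
  shows "of_nat (lucas n) = p ^ n + q ^ n"
proof (induction n rule: lucas.induct)
  case (3 n)
  have step: "r ^ Suc (Suc n) = r ^ Suc n + r ^ n" if "r\<^sup>2 = r + 1" for r :: 'a
    using that by (metis add_2_eq_Suc distrib_right mult.left_neutral power_Suc power_add)
  show ?case
    using 3 by (simp only: lucas.simps of_nat_add step[OF assms(2)] step[OF assms(3)] add_ac)
qed (use assms in auto)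

text \<open>The witnesses are p^(2m) and q^(2m) for the golden ratio p and its conjugate q. The even
  exponent makes both positive, although q < 0, and turns p q = -1 into product 1.\<close>

lemma lucas_mult_eq_power_sum:
  obtains a b :: real
  where "a > 0" "b > 0" "a * b = 1" "\<And>k. real (lucas (2 * m * k)) = a ^ k + b ^ k"
proof -
  define p q :: real where "p = (1 + sqrt 5) / 2" and "q = (1 - sqrt 5) / 2"
  have pq: "p + q = 1" "p\<^sup>2 = p + 1" "q\<^sup>2 = q + 1" "p * q = - 1"
    by (auto simp: p_def q_def power2_eq_square field_simps)
  then have "p \<noteq> 0" "q \<noteq> 0"
    by auto
  then have "p ^ (2 * m) > 0" "q ^ (2 * m) > 0"
    by (simp_all add: power_mult)
  moreover have "p ^ (2 * m) * q ^ (2 * m) = 1"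
    by (simp add: pq(4) flip: power_mult_distrib)
  moreover have "real (lucas (2 * m * k)) = (p ^ (2 * m)) ^ k + (q ^ (2 * m)) ^ k" for k
    using lucas_eq_power_sum[OF pq(1-3), of "2 * m * k"] by (simp add: power_mult)
  ultimately show thesis
    by (rule that)
qed

lemma arctan_sums:
  assumes "\<bar>x\<bar> \<le> 1"
  shows "(\<lambda>n. (- 1) ^ n / real (2 * n + 1) * x ^ (2 * n + 1)) sums arctan x"
  using summable_sums[OF summable_arctan_series[OF assms]] arctan_series[OF assms]
  by (simp add: mult.commute)

text \<open>With s = sqrt (L^2 + 4), (s - L) (s + L) = 4, so the fraction equals (s - L) / 2, the
  root given by the quadratic formula.\<close>

lemma quadratic_positive_root:
  fixes L :: real
  defines "x \<equiv> 2 / (L + sqrt (L\<^sup>2 + 4))"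
  shows "x > 0" "x\<^sup>2 + L * x = 1"
proof -
  define s where "s = sqrt (L\<^sup>2 + 4)"
  have s: "s\<^sup>2 = L\<^sup>2 + 4"
    by (simp add: s_def)
  \<comment> \<open>Bounding the absolute value keeps the denominator positive for negative L
    too.\<close>
  have "\<bar>L\<bar> < s"
    unfolding s_def by (rule real_less_rsqrt) simp
  then have pos: "L + s > 0"
    by linarith
  have x: "x = 2 / (L + s)"
    by (simp add: x_def s_def)
  then show "x > 0"
    using pos by simp
  have "x\<^sup>2 + L * x = (4 + 2 * L * (L + s)) / (L + s)\<^sup>2"
    using pos by (simp add: x add_divide_distrib power2_eq_square)
  also have "4 + 2 * L * (L + s) = (L + s)\<^sup>2"
    using s by (simp add: power2_eq_square algebra_simps)
  finally show "x\<^sup>2 + L * x = 1"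
    using pos by simp
qed

theorem theorem4:
  fixes m :: nat
  shows "(\<lambda>n::nat. (- 1) ^ n / real (2 * n + 1) * real (lucas (2 * m * (2 * n + 1)))
            * (2 / (real (lucas (2 * m)) + sqrt ((real (lucas (2 * m)))\<^sup>2 + 4))) ^ (2 * n + 1))
         sums (pi / 4)"
proof -
  obtain a b :: real where ab: "a > 0" "b > 0" "a * b = 1"
    and lucas: "\<And>k. real (lucas (2 * m * k)) = a ^ k + b ^ k"
    using lucas_mult_eq_power_sum by blast
  define x where "x = 2 / (real (lucas (2 * m)) + sqrt ((real (lucas (2 * m)))\<^sup>2 + 4))"
  have x: "x > 0" "x\<^sup>2 + (a + b) * x = 1"
    using quadratic_positive_root[of "real (lucas (2 * m))"] lucas[of 1] by (simp_all add: x_def)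
  have sum: "a * x + b * x = 1 - x\<^sup>2"
    using x(2) by (simp add: algebra_simps)
  have prod: "(a * x) * (b * x) = x\<^sup>2"
    using ab(3) by (simp add: power2_eq_square algebra_simps)
  have pos: "a * x > 0" "b * x > 0" "x\<^sup>2 > 0"
    using ab x(1) by simp_all
  \<comment> \<open>Two positive numbers with sum 1 - x^2 < 1 are each below 1, as both the arctan
    series and the addition theorem require.\<close>
  then have less: "\<bar>a * x\<bar> < 1" "\<bar>b * x\<bar> < 1"
    using sum by linarith+
  \<comment> \<open>This makes 1 - x^2 nonzero, so the quotient in the addition theorem cancels to
    1.\<close>
  have "x\<^sup>2 < 1"
    using sum pos by linarith
  then have "arctan (a * x) + arctan (b * x) = pi / 4"
    using arctan_add[of "a * x" "b * x"] less sum prod by (simp add: arctan_one)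
  moreover have "(\<lambda>n. (- 1) ^ n / real (2 * n + 1) * (a * x) ^ (2 * n + 1)
      + (- 1) ^ n / real (2 * n + 1) * (b * x) ^ (2 * n + 1))
    sums (arctan (a * x) + arctan (b * x))"
    using less by (intro sums_add arctan_sums) simp_all
  \<comment> \<open>The fact \<open>lucas\<close> at k = 2n + 1 splits each coefficient into two
    powers; distributing x^(2n + 1) over them matches the two arctan series term by term.\<close>
  ultimately show ?thesis
    unfolding x_def[symmetric] lucas power_mult_distrib by (simp only: algebra_simps)
qed

end
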